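(* In the setting of the context, let $\epsilon>0$ and $\alpha_\epsilon>1$, let $\gamma$ be a constant bigger than the finite sum $\sum_{t=1}^\infty t^{-\alpha_\epsilon}$, and for all $t\ge1$ set $$\epsilon_t=\epsilon\Big(\gamma\, t^{\alpha_\epsilon}\max_{\boldsymbol\theta\in\bigcup_{b\in\mathcal B}\boldsymbol\Theta_b}\|\boldsymbol\theta\|_1\Big)^{-1},\qquad \boldsymbol\Theta_b=\bigcup_{s\in\mathcal S}\boldsymbol\Theta_{b,s}.$$ Suppose that at time $t$ the decision maker knows $s_{t-1}$, and let $b_t^*=b_t^*(s_{t-1})$ and $\boldsymbol a_t^*=\boldsymbol a_t^*(s_{t-1})$ be the arm and action prescribed by the policy of the algorithm described in the context. Let the decision maker play the arm $b_t^*$ and, instead of $\boldsymbol a_t^*$, an action $\boldsymbol a_t$ chosen randomly from the set $B(\boldsymbol a_t^*,\epsilon_t)\cap\mathcal A$. Then: (i) The following two conditions can be fulfilled simultaneously, and the random choice of $\boldsymbol a_t$ fulfills them with probability one: (A1) $\boldsymbol a_t\in B(\boldsymbol a_t^*,\epsilon_t)\cap\mathcal A$; (A2) for $\tilde{\boldsymbol\theta},\check{\boldsymbol\theta}\in\boldsymbol\Theta_{b_t^*}$, $\langle\boldsymbol a_t,\tilde{\boldsymbol\theta}\rangle=\langle\boldsymbol a_t,\check{\boldsymbol\theta}\rangle$ if and only if $\tilde{\boldsymbol\theta}=\check{\boldsymbol\theta}$. Consequently, the event that $\boldsymbol\theta_t$ and the state $s_t$ cannot be recovered uniquely from the reward $r_t=\langle\boldsymbol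 a_t,\boldsymbol\theta_t\rangle$ has probability zero, and the overall expected regret caused by state estimation error is zero. (ii) The expected regret caused by the state recovery process (that is, by playing the actions $\boldsymbol a_t$ instead of $\boldsymbol a_t^*$) is smaller than $\epsilon$ with probability one.
   Context: Model. $\mathcal S$ (states) and $\mathcal B$ (arms) are finite sets. The action set $\mathcal A\subset\mathbb R^N$ is an $N$-dimensional compact convex polytope. For each $(b,s)\in\mathcal B\times\mathcal S$, $\boldsymbol\Theta_{b,s}\subset\mathbb R^N$ is a finite set carrying a probability distribution $P_{\boldsymbol\Theta_{b,s}}$, and $\boldsymbol\Theta_{b,\tilde s}\cap\boldsymbol\Theta_{b,\check s}=\emptyset$ whenever $\tilde s\ne\check s$. The state process $(s_t)$ is a time-homogeneous, irreducible, aperiodic Markov chain on $\mathcal S$ with transition matrix $P_S$ and stationary distribution $\mu_S$. At each time $t$ the decision maker chooses an arm $b_t\in\mathcal B$ and an action $\boldsymbol a_t\in\mathcal A$ and receives the reward $r_t=\langle\boldsymbol a_t,\boldsymbol\theta_t\rangle$, where $\boldsymbol\theta_t=\boldsymbol\theta(b_t,s_t)$ is random with distribution $P_{\boldsymbol\Theta_{b_t,s_t}}$ on $\boldsymbol\Theta_{b_t,s_t}$. The decision maker knows $\mathcal A,\mathcal S,\mathcal B$ and the sets $\boldsymbol\Theta_{b,s}$, but neither $P_S$, nor the distributions $P_{\boldsymbol\Theta_{b,s}}$, nor the realizations of $s_t$ and $\boldsymbol\theta_t$; it observes only the rewards. $B(\boldsymbol c,r)$ is the Euclidean ball in $\mathbb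 R^N$ with center $\boldsymbol c$ and radius $r$. Regret. $R(T)=T\rho(\pi^* )-\sum_{t=1}^T r_t$, where for $\pi:\mathcal S\to\mathcal B\times\mathcal A$, $\pi(\tilde s)=(b_\pi(\tilde s),\boldsymbol a_\pi(\tilde s))$, $\rho(\pi)=\sum_{\tilde s,\check s}\mu_S(\tilde s)P_S(\tilde s,\check s)\sum_{\boldsymbol\theta\in\boldsymbol\Theta_{b_\pi(\tilde s),\check s}}P_{\boldsymbol\Theta_{b_\pi(\tilde s),\check s}}(\boldsymbol\theta)\langle\boldsymbol a_\pi(\tilde s),\boldsymbol\theta\rangle$, and $\pi^*$ maximizes $\rho$. Policy of the algorithm. Fix $\alpha>3$. Up to time $t-1$, let $N_t(s)$, $N_t(\tilde s,\check s)$, $N_t(b,s)$, $N_t(b,s,\boldsymbol\theta)$ count, respectively, occurrences of state $s$, transitions from $\tilde s$ to $\check s$, times at which arm $b$ was played and state $s$ was then observed, and occurrences of $\boldsymbol\theta\in\boldsymbol\Theta_{b,s}$ (all in terms of recovered states and vectors). Put $\mathrm{conf}_S(t,s)=\min\{1,\sqrt{\log(4(t-1)^\alpha|\mathcal S|^2)/(2N_t(s))}\}$ and $\mathrm{conf}_{\boldsymbol\Theta}(t,b,s)=\min\{1,\sqrt{\log(4(t-1)^\alpha|\boldsymbol\Theta_{b,s}||\mathcal B||\mathcal S|)/(2N_t(b,s))}\}$ (both set to 1 for $t=0,1$). The algorithm runs in rounds; round $k$ starts at time $t_k$ and lasts as long as $\mathrm{conf}_S(t,s)>\mathrm{conf}_S(t_k,s)/2$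 and $\mathrm{conf}_{\boldsymbol\Theta}(t,b,s)>\mathrm{conf}_{\boldsymbol\Theta}(t_k,b,s)/2$ for all $b,s$. At the start of round $k$ let $\hat P_{t_k}(\tilde s,\check s)=N_{t_k}(\tilde s,\check s)/N_{t_k}(\tilde s)$ (or $|\mathcal S|^{-1}$ if $N_{t_k}(\tilde s)=0$) and $\hat P_{t_k,\boldsymbol\Theta_{b,s}}(\boldsymbol\theta)=N_{t_k}(b,s,\boldsymbol\theta)/N_{t_k}(b,s)$ (or $|\boldsymbol\Theta_{b,s}|^{-1}$ if $N_{t_k}(b,s)=0$). For each $\tilde s\in\mathcal S$, $(b^*_{t_k}(\tilde s),\boldsymbol a^*_{t_k}(\tilde s))$ is the arm-action part of a maximizer, over $b\in\mathcal B$, $\boldsymbol a\in\mathcal A$ and probability distributions $\tilde P_{\boldsymbol\Theta_{b,\check s}}$ on $\boldsymbol\Theta_{b,\check s}$ satisfying $|\tilde P_{\boldsymbol\Theta_{b,\check s}}(\boldsymbol\theta)-\hat P_{t_k,\boldsymbol\Theta_{b,\check s}}(\boldsymbol\theta)|\le\mathrm{conf}_{\boldsymbol\Theta}(t_k,b,\check s)$, of $\sum_{\check s\in\mathcal S}\hat P_{t_k}(\tilde s,\check s)\sum_{\boldsymbol\theta\in\boldsymbol\Theta_{b,\check s}}\tilde P_{\boldsymbol\Theta_{b,\check s}}(\boldsymbol\theta)\langle\boldsymbol a,\boldsymbol\theta\rangle$. For every $t$ in round $k$, $(b_t^*(\tilde s),\boldsymbol a_t^*(\tilde s))=(b^*_{t_k}(\tilde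 s),\boldsymbol a^*_{t_k}(\tilde s))$. *)

theory Defs
  imports "HOL-Probability.Probability"
begin

section \<open>The model\<close>

text \<open>States and arms are the elements of finite types. The stationary distribution is a field of
  the record; \<open>bandit_model\<close> ties it to the transition law.\<close>

record ('b, 's, 'n) bandit =
  action_set :: "(real^'n::finite) set"
  Theta :: "'b \<Rightarrow> 's \<Rightarrow> (real^'n) set"
  Theta_law :: "'b \<Rightarrow> 's \<Rightarrow> (real^'n) pmf"
  trans_law :: "'s \<Rightarrow> 's pmf"
  stat_law :: "'s pmf"

definition Theta_arm :: "('b, 's, 'n::finite) bandit \<Rightarrow> 'b \<Rightarrow> (real^'n) set" where
  "Theta_arm B b = (\<Union>s. Theta B b s)"

primrec nstep :: "('s \<Rightarrow> 's pmf) \<Rightarrow> nat \<Rightarrow> 's \<Rightarrow> 's pmf" where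
  "nstep P 0 s = return_pmf s"
| "nstep P (Suc n) s = bind_pmf (P s) (nstep P n)"

definition irreducible_chain :: "('s \<Rightarrow> 's pmf) \<Rightarrow> bool" where
  "irreducible_chain P \<longleftrightarrow> (\<forall>s s'. \<exists>n. pmf (nstep P n s) s' > 0)"

definition aperiodic_chain :: "('s \<Rightarrow> 's pmf) \<Rightarrow> bool" where
  "aperiodic_chain P \<longleftrightarrow> (\<forall>s. Gcd {n. n > 0 \<and> pmf (nstep P n s) s > 0} = 1)"

definition stationary_for :: "('s \<Rightarrow> 's pmf) \<Rightarrow> 's pmf \<Rightarrow> bool" where
  "stationary_for P \<mu> \<longleftrightarrow> bind_pmf \<mu> P = \<mu>"

definition bandit_model :: "('b::finite, 's::finite, 'n::finite) bandit \<Rightarrow> bool" where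
  "bandit_model B \<longleftrightarrow>
     polytope (action_set B) \<and> aff_dim (action_set B) = int CARD('n) \<and>
     (\<forall>b s. finite (Theta B b s) \<and> set_pmf (Theta_law B b s) \<subseteq> Theta B b s) \<and>
     (\<forall>b s s'. s \<noteq> s' \<longrightarrow> Theta B b s \<inter> Theta B b s' = {}) \<and>
     irreducible_chain (trans_law B) \<and> aperiodic_chain (trans_law B) \<and>
     stationary_for (trans_law B) (stat_law B)"


section \<open>Regret\<close>

definition rho ::
  "('b, 's::finite, 'n::finite) bandit \<Rightarrow> ('s \<Rightarrow> 'b \<times> (real^'n)) \<Rightarrow> real" where
  "rho B \<pi> = (\<Sum>s\<in>UNIV. \<Sum>s'\<in>UNIV. pmf (stat_law B) s * pmf (trans_law B s) s' *
     (\<Sum>v\<in>Theta B (fst (\<pi> s)) s'. pmf (Theta_law B (fst (\<pi> s)) s') v * (snd (\<pi> s) \<bullet> v)))"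

definition admissible_policy ::
  "('b, 's, 'n::finite) bandit \<Rightarrow> ('s \<Rightarrow> 'b \<times> (real^'n)) \<Rightarrow> bool" where
  "admissible_policy B \<pi> \<longleftrightarrow> (\<forall>s. snd (\<pi> s) \<in> action_set B)"

definition optimal_policy ::
  "('b, 's::finite, 'n::finite) bandit \<Rightarrow> ('s \<Rightarrow> 'b \<times> (real^'n)) \<Rightarrow> bool" where
  "optimal_policy B \<pi> \<longleftrightarrow>
     admissible_policy B \<pi> \<and> (\<forall>\<pi>'. admissible_policy B \<pi>' \<longrightarrow> rho B \<pi>' \<le> rho B \<pi>)"

definition regret ::
  "('b, 's::finite, 'n::finite) bandit \<Rightarrow> ('s \<Rightarrow> 'b \<times> (real^'n)) \<Rightarrow>
   (nat \<Rightarrow> 'w \<Rightarrow> real) \<Rightarrow> nat \<Rightarrow> 'w \<Rightarrow> real" where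
  "regret B \<pi> r T \<omega> = real T * rho B \<pi> - (\<Sum>t=1..T. r t \<omega>)"


section \<open>The policy of the algorithm\<close>

text \<open>What the decision maker has recorded. Arms and reward vectors have times \<open>1, 2, \<dots>\<close>; states
  have times \<open>0, 1, 2, \<dots>\<close>, since the state at time \<open>0\<close> is known when the first decision is made.
  All counts at \<open>t\<close> involve only times up to \<open>t - 1\<close>.\<close>

record ('b, 's, 'n) record_book =
  h_arm :: "nat \<Rightarrow> 'b"
  h_state :: "nat \<Rightarrow> 's"
  h_theta :: "nat \<Rightarrow> real^'n::finite"

definition N_state :: "('b, 's, 'n::finite) record_book \<Rightarrow> nat \<Rightarrow> 's \<Rightarrow> nat" where
  "N_state h t s = card {i. i < t \<and> h_state h i = s}"

definition N_trans :: "('b, 's, 'n::finite) record_book \<Rightarrow> nat \<Rightarrow> 's \<Rightarrow> 's \<Rightarrow> nat" where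
  "N_trans h t s s' = card {i. Suc i < t \<and> h_state h i = s \<and> h_state h (Suc i) = s'}"

definition N_arm :: "('b, 's, 'n::finite) record_book \<Rightarrow> nat \<Rightarrow> 'b \<Rightarrow> 's \<Rightarrow> nat" where
  "N_arm h t b s = card {i. 1 \<le> i \<and> i < t \<and> h_arm h i = b \<and> h_state h i = s}"

definition N_theta ::
  "('b, 's, 'n::finite) record_book \<Rightarrow> nat \<Rightarrow> 'b \<Rightarrow> 's \<Rightarrow> real^'n \<Rightarrow> nat" where
  "N_theta h t b s v =
     card {i. 1 \<le> i \<and> i < t \<and> h_arm h i = b \<and> h_state h i = s \<and> h_theta h i = v}"

text \<open>A zero count makes the square root infinite, so the minimum is \<open>1\<close>.\<close>

definition conf_S ::
  "real \<Rightarrow> ('b, 's::finite, 'n::finite) record_book \<Rightarrow> nat \<Rightarrow> 's \<Rightarrow> real" where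
  "conf_S \<alpha> h t s =
     (if t \<le> 1 \<or> N_state h t s = 0 then 1
      else min 1 (sqrt (ln (4 * real (t - 1) powr \<alpha> * (real CARD('s))\<^sup>2) /
                        (2 * real (N_state h t s)))))"

definition conf_Theta ::
  "('b::finite, 's::finite, 'n::finite) bandit \<Rightarrow> real \<Rightarrow> ('b, 's, 'n) record_book \<Rightarrow>
   nat \<Rightarrow> 'b \<Rightarrow> 's \<Rightarrow> real" where
  "conf_Theta B \<alpha> h t b s =
     (if t \<le> 1 \<or> N_arm h t b s = 0 then 1
      else min 1 (sqrt (ln (4 * real (t - 1) powr \<alpha> * real (card (Theta B b s)) *
                            real CARD('b) * real CARD('s)) /
                        (2 * real (N_arm h t b s)))))"

text \<open>\<open>round_start B \<alpha> h t\<close> is the starting time of the round to which \<open>t\<close> belongs. The first round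
  starts at time \<open>1\<close>; the value at \<open>0\<close> only serves the recursion and yields the value \<open>1\<close> at \<open>1\<close>.\<close>

primrec round_start ::
  "('b::finite, 's::finite, 'n::finite) bandit \<Rightarrow> real \<Rightarrow> ('b, 's, 'n) record_book \<Rightarrow>
   nat \<Rightarrow> nat" where
  "round_start B \<alpha> h 0 = 1"
| "round_start B \<alpha> h (Suc t) =
     (if (\<forall>s. conf_S \<alpha> h (Suc t) s > conf_S \<alpha> h (round_start B \<alpha> h t) s / 2) \<and>
         (\<forall>b s. conf_Theta B \<alpha> h (Suc t) b s >
                conf_Theta B \<alpha> h (round_start B \<alpha> h t) b s / 2)
      then round_start B \<alpha> h t else Suc t)"

definition P_hat ::
  "('b, 's::finite, 'n::finite) record_book \<Rightarrow> nat \<Rightarrow> 's \<Rightarrow> 's \<Rightarrow> real" where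
  "P_hat h t s s' =
     (if N_state h t s = 0 then 1 / real CARD('s)
      else real (N_trans h t s s') / real (N_state h t s))"

definition P_hat_Theta ::
  "('b, 's, 'n::finite) bandit \<Rightarrow> ('b, 's, 'n) record_book \<Rightarrow> nat \<Rightarrow>
   'b \<Rightarrow> 's \<Rightarrow> real^'n \<Rightarrow> real" where
  "P_hat_Theta B h t b s v =
     (if N_arm h t b s = 0 then 1 / real (card (Theta B b s))
      else real (N_theta h t b s v) / real (N_arm h t b s))"

definition plausible ::
  "('b::finite, 's::finite, 'n::finite) bandit \<Rightarrow> real \<Rightarrow> ('b, 's, 'n) record_book \<Rightarrow> nat \<Rightarrow>
   'b \<Rightarrow> ('s \<Rightarrow> (real^'n) pmf) \<Rightarrow> bool" where
  "plausible B \<alpha> h t b Q \<longleftrightarrow>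
     (\<forall>s. set_pmf (Q s) \<subseteq> Theta B b s \<and>
          (\<forall>v\<in>Theta B b s. \<bar>pmf (Q s) v - P_hat_Theta B h t b s v\<bar> \<le> conf_Theta B \<alpha> h t b s))"

definition objective ::
  "('b, 's::finite, 'n::finite) bandit \<Rightarrow> ('b, 's, 'n) record_book \<Rightarrow> nat \<Rightarrow> 's \<Rightarrow>
   'b \<Rightarrow> real^'n \<Rightarrow> ('s \<Rightarrow> (real^'n) pmf) \<Rightarrow> real" where
  "objective B h t s b a Q =
     (\<Sum>s'\<in>UNIV. P_hat h t s s' * (\<Sum>v\<in>Theta B b s'. pmf (Q s') v * (a \<bullet> v)))"

definition optimistic ::
  "('b::finite, 's::finite, 'n::finite) bandit \<Rightarrow> real \<Rightarrow> ('b, 's, 'n) record_book \<Rightarrow> nat \<Rightarrow>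
   's \<Rightarrow> 'b \<Rightarrow> real^'n \<Rightarrow> bool" where
  "optimistic B \<alpha> h t s b a \<longleftrightarrow>
     a \<in> action_set B \<and>
     (\<exists>Q. plausible B \<alpha> h t b Q \<and>
          (\<forall>b' a' Q'. a' \<in> action_set B \<and> plausible B \<alpha> h t b' Q' \<longrightarrow>
                      objective B h t s b' a' Q' \<le> objective B h t s b a Q))"


section \<open>Playing with state recovery\<close>

text \<open>A run consists of stochastic processes on a common sample space: the states (from time \<open>0\<close>),
  the reward vectors, the arms and actions played (from time \<open>1\<close>), and the policy
  \<open>(pol_arm t \<omega>, pol_action t \<omega>)\<close> held by the algorithm at time \<open>t\<close>.\<close>

record ('w, 'b, 's, 'n) run =
  state :: "nat \<Rightarrow> 'w \<Rightarrow> 's"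
  theta :: "nat \<Rightarrow> 'w \<Rightarrow> real^'n::finite"
  arm :: "nat \<Rightarrow> 'w \<Rightarrow> 'b"
  action :: "nat \<Rightarrow> 'w \<Rightarrow> real^'n"
  pol_arm :: "nat \<Rightarrow> 'w \<Rightarrow> 's \<Rightarrow> 'b"
  pol_action :: "nat \<Rightarrow> 'w \<Rightarrow> 's \<Rightarrow> real^'n"

definition reward :: "('w, 'b, 's, 'n::finite) run \<Rightarrow> nat \<Rightarrow> 'w \<Rightarrow> real" where
  "reward R t \<omega> = action R t \<omega> \<bullet> theta R t \<omega>"

text \<open>Recovery uses only the arm, the action and the reward; if several vectors explain the
  reward, the recovered one is unspecified and may be wrong.\<close>

definition rec_theta ::
  "('b, 's, 'n::finite) bandit \<Rightarrow> ('w, 'b, 's, 'n) run \<Rightarrow> nat \<Rightarrow> 'w \<Rightarrow> real^'n" where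
  "rec_theta B R t \<omega> =
     (SOME v. v \<in> Theta_arm B (arm R t \<omega>) \<and> action R t \<omega> \<bullet> v = reward R t \<omega>)"

definition rec_state ::
  "('b, 's, 'n::finite) bandit \<Rightarrow> ('w, 'b, 's, 'n) run \<Rightarrow> nat \<Rightarrow> 'w \<Rightarrow> 's" where
  "rec_state B R t \<omega> =
     (if t = 0 then state R 0 \<omega> else (SOME s. rec_theta B R t \<omega> \<in> Theta B (arm R t \<omega>) s))"

definition rec_book ::
  "('b, 's, 'n::finite) bandit \<Rightarrow> ('w, 'b, 's, 'n) run \<Rightarrow> 'w \<Rightarrow> ('b, 's, 'n) record_book" where
  "rec_book B R \<omega> =
     \<lparr>h_arm = (\<lambda>t. arm R t \<omega>), h_state = (\<lambda>t. rec_state B R t \<omega>),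
      h_theta = (\<lambda>t. rec_theta B R t \<omega>)\<rparr>"

definition plays_algorithm ::
  "('b::finite, 's::finite, 'n::finite) bandit \<Rightarrow> real \<Rightarrow> 'w measure \<Rightarrow>
   ('w, 'b, 's, 'n) run \<Rightarrow> bool" where
  "plays_algorithm B \<alpha> M R \<longleftrightarrow>
     (\<forall>\<omega>\<in>space M. \<forall>t\<ge>1.
        arm R t \<omega> = pol_arm R t \<omega> (rec_state B R (t - 1) \<omega>) \<and>
        (let h = rec_book B R \<omega>; k = round_start B \<alpha> h t in
           \<forall>s. optimistic B \<alpha> h k s (pol_arm R k \<omega> s) (pol_action R k \<omega> s) \<and>
               pol_arm R t \<omega> s = pol_arm R k \<omega> s \<and> pol_action R t \<omega> s = pol_action R k \<omega> s))"

text \<open>\<open>F t\<close> is the history up to and including time \<open>t\<close>. The conditional law given \<open>F (t - 1)\<close> says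
  that the action is uniformly distributed on the part of the action set within distance \<open>\<delta> t\<close> of the
  prescribed action, that the next state follows the transition law, independently of the choice
  of the action, and that the reward vector is then drawn from the law of the played arm and the
  new state.\<close>

definition randomized_run ::
  "('b::finite, 's::finite, 'n::finite) bandit \<Rightarrow> (nat \<Rightarrow> real) \<Rightarrow> 'w measure \<Rightarrow>
   (nat \<Rightarrow> 'w measure) \<Rightarrow> ('w, 'b, 's, 'n) run \<Rightarrow> bool" where
  "randomized_run B \<delta> M F R \<longleftrightarrow>
     prob_space M \<and> filtration (space M) F \<and> (\<forall>t. subalgebra M (F t)) \<and>
     (\<forall>t. state R t \<in> measurable (F t) (count_space UNIV)) \<and>
     (\<forall>t\<ge>1. theta R t \<in> borel_measurable (F t) \<and> action R t \<in> borel_measurable (F t) \<and>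
        (\<forall>s. (\<lambda>\<omega>. pol_arm R t \<omega> s) \<in> measurable (F (t - 1)) (count_space UNIV) \<and>
             (\<lambda>\<omega>. pol_action R t \<omega> s) \<in> borel_measurable (F (t - 1)))) \<and>
     (\<forall>t\<ge>1. \<forall>\<omega>\<in>space M. theta R t \<omega> \<in> Theta B (arm R t \<omega>) (state R t \<omega>)) \<and>
     (\<forall>t\<ge>1. \<forall>X\<in>sets borel. \<forall>s v. AE \<omega> in M.
        real_cond_exp M (F (t - 1))
          (indicator {\<omega>\<in>space M. action R t \<omega> \<in> X \<and> state R t \<omega> = s \<and> theta R t \<omega> = v}) \<omega> =
        measure (uniform_measure lborel
                   (ball (pol_action R t \<omega> (rec_state B R (t - 1) \<omega>)) (\<delta> t) \<inter> action_set B)) X *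
        pmf (trans_law B (state R (t - 1) \<omega>)) s * pmf (Theta_law B (arm R t \<omega>) s) v)"

definition norm1 :: "real^'n::finite \<Rightarrow> real" where
  "norm1 x = (\<Sum>i\<in>UNIV. \<bar>x $ i\<bar>)"

definition eps_seq ::
  "('b, 's, 'n::finite) bandit \<Rightarrow> real \<Rightarrow> real \<Rightarrow> real \<Rightarrow> nat \<Rightarrow> real" where
  "eps_seq B \<epsilon> \<gamma> \<alpha>\<^sub>\<epsilon> t =
     \<epsilon> * inverse (\<gamma> * real t powr \<alpha>\<^sub>\<epsilon> * Max (norm1 ` (\<Union>b. Theta_arm B b)))"

definition cond_A1 :: "('b, 's, 'n::finite) bandit \<Rightarrow> real \<Rightarrow> real^'n \<Rightarrow> real^'n \<Rightarrow> bool" where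
  "cond_A1 B \<delta> a' a \<longleftrightarrow> a \<in> ball a' \<delta> \<inter> action_set B"

definition cond_A2 :: "('b, 's, 'n::finite) bandit \<Rightarrow> 'b \<Rightarrow> real^'n \<Rightarrow> bool" where
  "cond_A2 B b a \<longleftrightarrow> (\<forall>v\<in>Theta_arm B b. \<forall>w\<in>Theta_arm B b. a \<bullet> v = a \<bullet> w \<longleftrightarrow> v = w)"

text \<open>The event that the arm, the action and the reward at time \<open>t\<close> do not determine a unique pair
  of a state and a vector.\<close>

definition unrecoverable ::
  "('b, 's, 'n::finite) bandit \<Rightarrow> 'w measure \<Rightarrow> ('w, 'b, 's, 'n) run \<Rightarrow> nat \<Rightarrow> 'w set" where
  "unrecoverable B M R t =
     {\<omega>\<in>space M. \<not> (\<exists>!(s, v). v \<in> Theta B (arm R t \<omega>) s \<and> action R t \<omega> \<bullet> v = reward R t \<omega>)}"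

definition estimation_error ::
  "('b, 's, 'n::finite) bandit \<Rightarrow> 'w measure \<Rightarrow> ('w, 'b, 's, 'n) run \<Rightarrow> nat \<Rightarrow> 'w set" where
  "estimation_error B M R T =
     {\<omega>\<in>space M. \<exists>t\<in>{1..T}. rec_state B R t \<omega> \<noteq> state R t \<omega> \<or> rec_theta B R t \<omega> \<noteq> theta R t \<omega>}"

text \<open>The contribution to the regret of the event that some state or vector is recovered wrongly.\<close>

definition error_regret ::
  "('b, 's::finite, 'n::finite) bandit \<Rightarrow> ('s \<Rightarrow> 'b \<times> (real^'n)) \<Rightarrow> 'w measure \<Rightarrow>
   ('w, 'b, 's, 'n) run \<Rightarrow> nat \<Rightarrow> 'w \<Rightarrow> real" where
  "error_regret B \<pi> M R T \<omega> =
     regret B \<pi> (reward R) T \<omega> * indicator (estimation_error B M R T) \<omega>"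

text \<open>Regret of the actions played minus regret of the prescribed actions, on the same states
  and reward vectors.\<close>

definition recovery_regret ::
  "('b, 's::finite, 'n::finite) bandit \<Rightarrow> ('s \<Rightarrow> 'b \<times> (real^'n)) \<Rightarrow>
   ('w, 'b, 's, 'n) run \<Rightarrow> nat \<Rightarrow> 'w \<Rightarrow> real" where
  "recovery_regret B \<pi> R T \<omega> =
     regret B \<pi> (reward R) T \<omega> -
     regret B \<pi> (\<lambda>t \<omega>. pol_action R t \<omega> (state R (t - 1) \<omega>) \<bullet> theta R t \<omega>) T \<omega>"

definition action_algebra :: "'w measure \<Rightarrow> ('w, 'b, 's, 'n::finite) run \<Rightarrow> 'w measure" where
  "action_algebra M R =
     sigma (space M) {action R t -` X \<inter> space M | t X. t \<ge> 1 \<and> X \<in> sets borel}"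

end

theory Submission
  imports Defs
begin

text \<open>Actions that fail to separate two of the finitely many reward vectors lie in a finite union of
  hyperplanes, a fixed Lebesgue null set. The part of the full-dimensional polytope near the prescribed
  action has positive volume, so the uniformly chosen action almost surely avoids these hyperplanes, and
  then the reward determines the vector, hence the state. By the Cauchy--Schwarz inequality, moving the
  action by less than \<open>\<epsilon>\<^sub>t\<close> costs at most \<open>\<epsilon>\<^sub>t max \<parallel>\<theta>\<parallel>\<^sub>1 = (\<epsilon> / \<gamma>) t powr (- \<alpha>\<^sub>\<epsilon>)\<close>;
  these costs add up to a bound below \<open>\<epsilon>\<close> that does not depend on the horizon.\<close>

section \<open>Uniform choice in a ball\<close>

text \<open>A convex set with nonempty interior lies in the closure of that interior. So even around
  a boundary point \<open>x\<close> the ball meets the interior in a nonempty open set, which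
  contains a small ball.\<close>

lemma emeasure_ball_Int_convex_pos:
  fixes A :: "'a::euclidean_space set"
  assumes "convex A" "interior A \<noteq> {}" "A \<in> sets borel" "x \<in> A" "0 < r"
  shows "0 < emeasure lborel (ball x r \<inter> A)"
proof -
  have "x \<in> closure (interior A)"
    using assms convex_closure_interior closure_subset by blast
  then obtain y where y: "y \<in> interior A" "dist y x < r"
    using \<open>0 < r\<close> by (auto simp: closure_approachable)
  then have "y \<in> ball x r \<inter> interior A" by (simp add: dist_commute)
  moreover have "open (ball x r \<inter> interior A)" by auto
  ultimately obtain e where e: "e > 0" "ball y e \<subseteq> ball x r \<inter> interior A"
    by (meson open_contains_ball)
  have "0 < emeasure lborel (ball y e)"
    using content_ball_pos[OF e(1), of y] by (simp add: measure_def enn2real_positive_iff)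
  also have "\<dots> \<le> emeasure lborel (ball x r \<inter> A)"
    using e(2) interior_subset[of A] assms(3) by (intro emeasure_mono) auto
  finally show ?thesis .
qed

text \<open>Negligibility only gives a null set of the completed measure \<open>lebesgue\<close>;
  closedness makes it Borel, hence null for \<open>lborel\<close>.\<close>

lemma null_sets_lborel_hyperplane:
  fixes w :: "'a::euclidean_space"
  assumes "w \<noteq> 0"
  shows "{x. w \<bullet> x = 0} \<in> null_sets lborel"
proof -
  have "{x. w \<bullet> x = 0} \<in> null_sets lebesgue"
    using negligible_hyperplane[of w 0] assms by (simp add: negligible_iff_null_sets)
  moreover have "{x. w \<bullet> x = 0} \<in> sets lborel"
    by (simp add: closed_hyperplane borel_closed)
  ultimately show ?thesis by (simp add: null_sets_completion_iff)
qed

lemma emeasure_ball_Int_lt_top: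
  fixes c :: "'a::euclidean_space"
  shows "emeasure lborel (ball c r \<inter> A) < \<infinity>"
  by (intro emeasure_bounded_finite) auto

text \<open>The set is the section at \<open>c\<close> of a Borel set of pairs, and by
  sigma-finiteness the measure of a section depends measurably on the base point.\<close>

lemma measurable_emeasure_ball_Int:
  fixes A X :: "'a::euclidean_space set"
  assumes [measurable]: "A \<in> sets borel" "X \<in> sets borel"
  shows "(\<lambda>c. emeasure lborel (ball c r \<inter> A \<inter> X)) \<in> borel_measurable borel"
proof -
  have "{p\<in>space (borel \<Otimes>\<^sub>M borel). dist (fst p) (snd p) < r \<and> snd p \<in> A \<and> snd p \<in> X}
      \<in> sets (borel \<Otimes>\<^sub>M (borel :: 'a measure))"
    by measurable
  then have "(\<lambda>c. emeasure lborel (Pair c -` {p. dist (fst p) (snd p) < r \<and> snd p \<in> A \<and> snd p \<in> X}))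
      \<in> borel_measurable (borel :: 'a measure)"
    by (intro lborel.measurable_emeasure_Pair) (simp add: space_pair_measure cong: sets_pair_measure_cong)
  also have "(\<lambda>c. Pair c -` {p. dist (fst p) (snd p) < r \<and> snd p \<in> A \<and> snd p \<in> X})
      = (\<lambda>c. ball c r \<inter> A \<inter> X)"
    by (auto simp: fun_eq_iff)
  finally show ?thesis .
qed

lemma measurable_uniform_measure_ball:
  fixes A X :: "'a::euclidean_space set"
  assumes [measurable]: "A \<in> sets borel" "X \<in> sets borel"
  shows "(\<lambda>c. measure (uniform_measure lborel (ball c r \<inter> A)) X) \<in> borel_measurable borel"
  using measurable_emeasure_ball_Int[of A X r] measurable_emeasure_ball_Int[of A UNIV r]
  by (simp add: measure_def)

text \<open>The assumed law speaks of one set \<open>X\<close> at a time, whereas the ball has a random centre; so the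
  joint law of centre and action has to be identified first, as a density with respect to the law of
  the centre times Lebesgue measure.\<close>

lemma AE_mem_of_conditionally_uniform:
  fixes a c :: "'w \<Rightarrow> 'a::euclidean_space"
  assumes "prob_space M" and sub: "subalgebra M G"
    and c: "c \<in> borel_measurable G" and a[measurable]: "a \<in> borel_measurable M"
    and A[measurable]: "A \<in> sets borel"
    and law: "\<And>E X. E \<in> sets G \<Longrightarrow> X \<in> sets borel \<Longrightarrow>
      measure M (E \<inter> {\<omega>\<in>space M. a \<omega> \<in> X}) =
      (\<integral>\<omega>. indicator E \<omega> * measure (uniform_measure lborel (ball (c \<omega>) r \<inter> A)) X \<partial>M)"
  shows "AE \<omega> in M. a \<omega> \<in> ball (c \<omega>) r \<inter> A"
proof -
  interpret prob_space M by fact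
  have c'[measurable]: "c \<in> borel_measurable M"
    using measurable_from_subalg[OF sub c] .
  define m where "m = (\<lambda>x. emeasure lborel (ball x r \<inter> A))"
  have m[measurable]: "m \<in> borel_measurable borel"
    using measurable_emeasure_ball_Int[of A UNIV r] by (simp add: m_def)
  define P where "P = distr M borel c"
  interpret P: prob_space P unfolding P_def by (rule prob_space_distr) measurable
  have [simp, measurable_cong]: "sets P = sets borel" by (simp add: P_def)
  \<comment> \<open>Conditional density of the action at \<open>y\<close> given the centre
    \<open>x\<close>. Where \<open>m x = 0\<close> it is infinite only on a null set of
    \<open>y\<close>, in line with \<open>uniform_measure\<close>, whose quotient 0 / 0 is
    0.\<close>
  define f where "f = (\<lambda>(x, y). indicator {p. dist (fst p) (snd p) < r \<and> snd p \<in> A} (x, y) / m x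
    :: ennreal)"
  have "{p \<in> space (borel \<Otimes>\<^sub>M borel). dist (fst p) (snd p) < r \<and> snd p \<in> A}
      \<in> sets (borel \<Otimes>\<^sub>M (borel :: 'a measure))"
    by measurable
  then have D[measurable]: "{p. dist (fst p) (snd p) < r \<and> snd p \<in> A}
      \<in> sets (borel \<Otimes>\<^sub>M (borel :: 'a measure))"
    by (simp add: space_pair_measure)
  have f[measurable]: "f \<in> borel_measurable (borel \<Otimes>\<^sub>M borel)"
    unfolding f_def by measurable
  have f'[measurable]: "f \<in> borel_measurable (P \<Otimes>\<^sub>M lborel)"
    using f by (simp cong: measurable_cong_sets sets_pair_measure_cong)
  interpret pair_sigma_finite P lborel ..
  \<comment> \<open>Compared on rectangles, a generator stable under intersection: the first side is
    the event that \<open>c\<close> lies in \<open>X\<close>, which belongs to \<open>G\<close>, and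
    the second side is a fixed set, so \<open>law\<close> applies.\<close>
  have eq: "distr M (borel \<Otimes>\<^sub>M borel) (\<lambda>\<omega>. (c \<omega>, a \<omega>)) = density (P \<Otimes>\<^sub>M lborel) f"
  proof (rule measure_eqI_generator_eq[OF Int_stable_pair_measure_generator[of borel borel]])
    show "{X \<times> Y |X Y. X \<in> sets borel \<and> Y \<in> sets borel} \<subseteq> Pow (UNIV :: ('a \<times> 'a) set)" by auto
    show "sets (distr M (borel \<Otimes>\<^sub>M borel) (\<lambda>\<omega>. (c \<omega>, a \<omega>))) =
        sigma_sets UNIV {X \<times> Y |X Y. X \<in> sets (borel :: 'a measure) \<and> Y \<in> sets (borel :: 'a measure)}"
      by (simp add: sets_pair_measure)
    show "sets (density (P \<Otimes>\<^sub>M lborel) f) =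
        sigma_sets UNIV {X \<times> Y |X Y. X \<in> sets (borel :: 'a measure) \<and> Y \<in> sets (borel :: 'a measure)}"
      by (simp add: sets_pair_measure P_def)
    show "range (\<lambda>_::nat. UNIV) \<subseteq> {X \<times> Y |X Y. X \<in> sets (borel :: 'a measure) \<and> Y \<in> sets (borel :: 'a measure)}"
      by (auto intro!: exI[of _ UNIV])
    show "emeasure (distr M (borel \<Otimes>\<^sub>M borel) (\<lambda>\<omega>. (c \<omega>, a \<omega>))) UNIV \<noteq> \<infinity>"
      using sets.top[of "borel \<Otimes>\<^sub>M (borel :: 'a measure)"]
      by (subst emeasure_distr) (auto simp: emeasure_eq_measure space_pair_measure)
  next
    fix Z :: "('a \<times> 'a) set"
    assume "Z \<in> {X \<times> Y |X Y. X \<in> sets (borel :: 'a measure) \<and> Y \<in> sets (borel :: 'a measure)}"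
    then obtain X Y where Z: "Z = X \<times> Y" and XY[measurable]: "X \<in> sets borel" "Y \<in> sets borel"
      by auto
    let ?k = "\<lambda>x. emeasure lborel (ball x r \<inter> A \<inter> Y) / m x"
    have k[measurable]: "?k \<in> borel_measurable borel"
      using measurable_emeasure_ball_Int[OF A XY(2), of r] m by measurable
    \<comment> \<open>This bound supplies integrability and lets \<open>enn2real\<close> be
      undone.\<close>
    have k_le: "?k x \<le> 1" for x
    proof -
      have "emeasure lborel (ball x r \<inter> A \<inter> Y) \<le> m x"
        unfolding m_def by (intro emeasure_mono) auto
      then show ?thesis
        by (cases "m x = 0") (auto intro!: divide_le_posI_ennreal simp: zero_less_iff_neq_zero)
    qed
    have k_meas: "measure (uniform_measure lborel (ball x r \<inter> A)) Y = enn2real (?k x)" for x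
      by (simp add: measure_def m_def)
    have "emeasure (distr M (borel \<Otimes>\<^sub>M borel) (\<lambda>\<omega>. (c \<omega>, a \<omega>))) Z
        = emeasure M ((c -` X \<inter> space M) \<inter> {\<omega>\<in>space M. a \<omega> \<in> Y})"
      by (subst emeasure_distr) (auto simp: Z intro!: arg_cong[where f="emeasure M"])
    also have "\<dots> = ennreal (\<integral>\<omega>. indicator (c -` X \<inter> space M) \<omega> * enn2real (?k (c \<omega>)) \<partial>M)"
    proof -
      have "c -` X \<inter> space M \<in> sets G"
        using measurable_sets[OF c XY(1)] sub by (simp add: subalgebra_def)
      then show ?thesis
        using law[of "c -` X \<inter> space M" Y] by (simp add: k_meas emeasure_eq_measure)
    qed
    also have "\<dots> = (\<integral>\<^sup>+\<omega>. ennreal (indicator (c -` X \<inter> space M) \<omega> * enn2real (?k (c \<omega>))) \<partial>M)"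
    proof (rule nn_integral_eq_integral[symmetric])
      have "enn2real (?k x) \<le> 1" for x
        using k_le[of x] by (simp add: enn2real_leI)
      then show "integrable M (\<lambda>\<omega>. indicator (c -` X \<inter> space M) \<omega> * enn2real (?k (c \<omega>)))"
        by (intro integrable_const_bound[where B=1]) (auto simp: indicator_def)
    qed auto
    also have "\<dots> = (\<integral>\<^sup>+\<omega>. indicator X (c \<omega>) * ?k (c \<omega>) \<partial>M)"
    proof (rule nn_integral_cong)
      fix \<omega> assume "\<omega> \<in> space M"
      moreover have "ennreal (enn2real (?k (c \<omega>))) = ?k (c \<omega>)"
        using k_le[of "c \<omega>"] by (intro ennreal_enn2real) (auto intro: le_less_trans)
      ultimately show "ennreal (indicator (c -` X \<inter> space M) \<omega> * enn2real (?k (c \<omega>)))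
          = indicator X (c \<omega>) * ?k (c \<omega>)"
        by (auto simp: indicator_def)
    qed
    also have "\<dots> = (\<integral>\<^sup>+x. indicator X x * ?k x \<partial>P)"
      unfolding P_def by (subst nn_integral_distr) auto
    also have "\<dots> = (\<integral>\<^sup>+x. (\<integral>\<^sup>+y. f (x, y) * indicator Z (x, y) \<partial>lborel) \<partial>P)"
    proof (rule nn_integral_cong)
      fix x
      have "(\<integral>\<^sup>+y. f (x, y) * indicator Z (x, y) \<partial>lborel)
          = (\<integral>\<^sup>+y. (indicator X x / m x) * indicator (ball x r \<inter> A \<inter> Y) y \<partial>lborel)"
        by (intro nn_integral_cong) (auto simp: f_def Z indicator_def)
      also have "\<dots> = (indicator X x / m x) * emeasure lborel (ball x r \<inter> A \<inter> Y)"
        by (subst nn_integral_cmult_indicator) auto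
      finally show "indicator X x * ?k x = (\<integral>\<^sup>+y. f (x, y) * indicator Z (x, y) \<partial>lborel)"
        by (simp add: indicator_def divide_ennreal_def mult_ac)
    qed
    also have "\<dots> = (\<integral>\<^sup>+p. f p * indicator Z p \<partial>(P \<Otimes>\<^sub>M lborel))"
      by (rule lborel.nn_integral_fst) (auto simp: Z cong: measurable_cong_sets)
    also have "\<dots> = emeasure (density (P \<Otimes>\<^sub>M lborel) f) Z"
      by (subst emeasure_density) (auto simp: Z)
    finally show "emeasure (distr M (borel \<Otimes>\<^sub>M borel) (\<lambda>\<omega>. (c \<omega>, a \<omega>))) Z
        = emeasure (density (P \<Otimes>\<^sub>M lborel) f) Z" .
  qed auto
  \<comment> \<open>The density vanishes off this set of pairs, and \<open>eq\<close> carries the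
    conclusion over to the joint law of centre and action.\<close>
  have "AE p in density (P \<Otimes>\<^sub>M lborel) f. dist (fst p) (snd p) < r \<and> snd p \<in> A"
    by (subst AE_density) (auto simp: f_def indicator_def of_bool_def intro!: AE_I2 split: if_splits)
  then have "AE p in distr M (borel \<Otimes>\<^sub>M borel) (\<lambda>\<omega>. (c \<omega>, a \<omega>)).
      dist (fst p) (snd p) < r \<and> snd p \<in> A"
    unfolding eq .
  then show ?thesis
    by (subst (asm) AE_distr_iff) auto
qed


section \<open>Runs with state recovery\<close>

text \<open>The radii are an arbitrary positive sequence: exact recovery rests on positivity alone,
  and the particular choice \<open>eps_seq\<close> enters only when the costs are summed.\<close>

locale recovery_run =
  fixes B :: "('b::finite, 's::finite, 'n::finite) bandit" and \<alpha> :: real and \<delta> :: "nat \<Rightarrow> real"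
    and M :: "'w measure" and F :: "nat \<Rightarrow> 'w measure" and R :: "('w, 'b, 's, 'n) run"
  assumes model: "bandit_model B" and run: "randomized_run B \<delta> M F R"
    and plays: "plays_algorithm B \<alpha> M R" and radius_pos: "\<And>t. 1 \<le> t \<Longrightarrow> 0 < \<delta> t"
begin

sublocale prob_space M
  using run by (simp add: randomized_run_def)

lemma subalgebra_F: "subalgebra M (F t)"
  using run by (simp add: randomized_run_def)

lemma space_F [simp]: "space (F t) = space M"
  using subalgebra_F by (simp add: subalgebra_def)

lemma measurable_F: "f \<in> measurable (F t) N \<Longrightarrow> f \<in> measurable M N"
  using measurable_from_subalg subalgebra_F by blast

lemma measurable_F_mono: "f \<in> measurable (F s) N \<Longrightarrow> s \<le> t \<Longrightarrow> f \<in> measurable (F t) N"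
  using run by (intro measurable_from_subalg[of "F t" "F s"])
    (auto simp: randomized_run_def subalgebra_def filtration_def)

lemma state_measurable: "state R t \<in> measurable (F t) (count_space UNIV)"
  using run by (simp add: randomized_run_def)

lemma theta_measurable: "1 \<le> t \<Longrightarrow> theta R t \<in> borel_measurable (F t)"
  using run by (simp add: randomized_run_def)

lemma action_measurable: "1 \<le> t \<Longrightarrow> action R t \<in> borel_measurable (F t)"
  using run by (simp add: randomized_run_def)

lemma pol_arm_measurable:
  "1 \<le> t \<Longrightarrow> (\<lambda>\<omega>. pol_arm R t \<omega> s) \<in> measurable (F (t - 1)) (count_space UNIV)"
  using run by (simp add: randomized_run_def)

lemma pol_action_measurable:
  "1 \<le> t \<Longrightarrow> (\<lambda>\<omega>. pol_action R t \<omega> s) \<in> borel_measurable (F (t - 1))"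
  using run by (simp add: randomized_run_def)

lemma theta_mem: "1 \<le> t \<Longrightarrow> \<omega> \<in> space M \<Longrightarrow> theta R t \<omega> \<in> Theta B (arm R t \<omega>) (state R t \<omega>)"
  using run by (simp add: randomized_run_def)

lemma arm_eq: "1 \<le> t \<Longrightarrow> \<omega> \<in> space M \<Longrightarrow> arm R t \<omega> = pol_arm R t \<omega> (rec_state B R (t - 1) \<omega>)"
  using plays by (simp add: plays_algorithm_def)

text \<open>The action held at \<open>t\<close> is the one fixed at the start of its round, where
  \<open>optimistic\<close> places it in the action set.\<close>

lemma pol_action_mem:
  assumes "1 \<le> t" "\<omega> \<in> space M"
  shows "pol_action R t \<omega> s \<in> action_set B"
  using plays assms unfolding plays_algorithm_def optimistic_def Let_def by metis

definition vectors :: "(real^'n) set" where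
  "vectors = (\<Union>b. Theta_arm B b)"

lemma Theta_subset_vectors: "Theta B b s \<subseteq> vectors"
  by (auto simp: vectors_def Theta_arm_def)

lemma Theta_arm_subset_vectors: "Theta_arm B b \<subseteq> vectors"
  by (auto simp: vectors_def)

lemma finite_vectors: "finite vectors"
  using model by (auto simp: vectors_def Theta_arm_def bandit_model_def)

lemma theta_mem_vectors: "1 \<le> t \<Longrightarrow> \<omega> \<in> space M \<Longrightarrow> theta R t \<omega> \<in> vectors"
  using theta_mem Theta_subset_vectors by blast

lemma Theta_state_unique: "v \<in> Theta B b s \<Longrightarrow> v \<in> Theta B b s' \<Longrightarrow> s = s'"
  using model unfolding bandit_model_def by blast

lemma action_set_borel [measurable]: "action_set B \<in> sets borel"
  using model by (auto simp: bandit_model_def intro!: borel_closed polytope_imp_closed)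

text \<open>Full affine dimension makes the interior equal to the relative interior, which is
  nonempty for a nonempty convex set.\<close>

lemma emeasure_ball_Int_action_set_pos:
  assumes "x \<in> action_set B" "0 < r"
  shows "0 < emeasure lborel (ball x r \<inter> action_set B)"
proof -
  have "convex (action_set B)"
    using model by (auto simp: bandit_model_def intro: polytope_imp_convex)
  moreover have "aff_dim (action_set B) = int DIM(real^'n)"
    using model by (simp add: bandit_model_def)
  then have "interior (action_set B) = rel_interior (action_set B)"
    by (simp add: interior_rel_interior_gen)
  ultimately show ?thesis
    using assms rel_interior_eq_empty[of "action_set B"]
    by (intro emeasure_ball_Int_convex_pos) auto
qed


subsection \<open>Measurability of the recovered data\<close>

text \<open>The recovered data are choices by \<open>SOME\<close>, even where recovery fails; they are measurable
  because they depend only on the arm and on this set, which takes finitely many values.\<close>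

definition candidates :: "nat \<Rightarrow> 'w \<Rightarrow> (real^'n) set" where
  "candidates t \<omega> = {v\<in>vectors. action R t \<omega> \<bullet> v = reward R t \<omega>}"

lemma candidates_measurable:
  assumes "1 \<le> t"
  shows "candidates t \<in> measurable (F t) (count_space UNIV)"
proof -
  have [measurable]: "theta R t \<in> borel_measurable (F t)" "action R t \<in> borel_measurable (F t)"
    using assms theta_measurable action_measurable by auto
  have "candidates t \<in> measurable (F t) (count_space (Pow vectors))"
  proof (subst measurable_count_space_eq2)
    have "candidates t -` {S} \<inter> space (F t) \<in> sets (F t)" if "S \<subseteq> vectors" for S
    proof -
      \<comment> \<open>Each fibre is cut out by finitely many conditions, one per vector, on the
        action and the true reward vector.\<close>
      have "candidates t \<omega> = S \<longleftrightarrow>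
          (\<forall>v\<in>vectors. action R t \<omega> \<bullet> v = action R t \<omega> \<bullet> theta R t \<omega> \<longleftrightarrow> v \<in> S)" for \<omega>
        using that unfolding candidates_def reward_def by blast
      then have "candidates t -` {S} \<inter> space (F t) =
          {\<omega>\<in>space (F t). \<forall>v\<in>vectors. action R t \<omega> \<bullet> v = action R t \<omega> \<bullet> theta R t \<omega> \<longleftrightarrow> v \<in> S}"
        by blast
      also have "\<dots> \<in> sets (F t)"
      proof (rule sets.sets_Collect_finite_All[OF _ finite_vectors])
        fix v
        show "{\<omega>\<in>space (F t). action R t \<omega> \<bullet> v = action R t \<omega> \<bullet> theta R t \<omega> \<longleftrightarrow> v \<in> S} \<in> sets (F t)"
          by measurable
      qed
      finally show ?thesis .
    qed
    then show "candidates t \<in> space (F t) \<rightarrow> Pow vectors \<and>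
        (\<forall>S\<in>Pow vectors. candidates t -` {S} \<inter> space (F t) \<in> sets (F t))"
      unfolding candidates_def by blast
  qed (use finite_vectors in simp)
  from measurable_compose[OF this, of "\<lambda>S. S" "count_space UNIV"] show ?thesis by simp
qed

definition pick_theta :: "'b \<Rightarrow> (real^'n) set \<Rightarrow> real^'n" where
  "pick_theta b S = (SOME v. v \<in> Theta_arm B b \<and> v \<in> S)"

text \<open>The predicates under the two choices coincide, so the choices agree even where several
  vectors explain the reward.\<close>

lemma rec_theta_eq: "rec_theta B R t \<omega> = pick_theta (arm R t \<omega>) (candidates t \<omega>)"
  unfolding rec_theta_def pick_theta_def candidates_def
  by (rule arg_cong[where f=Eps]) (use Theta_arm_subset_vectors in auto)

text \<open>Arms are finitely many and \<open>candidates\<close> is measurable into a discrete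
  space, so \<open>f\<close> may be arbitrary, including a function defined by
  \<open>SOME\<close>.\<close>

lemma measurable_of_arm_candidates:
  assumes "1 \<le> t" "arm R t \<in> measurable (F t) (count_space UNIV)"
  shows "(\<lambda>\<omega>. f (arm R t \<omega>) (candidates t \<omega>)) \<in> measurable (F t) (count_space UNIV)"
proof (rule measurable_compose_countable[where f="\<lambda>b \<omega>. f b (candidates t \<omega>)", OF _ assms(2)])
  show "(\<lambda>\<omega>. f b (candidates t \<omega>)) \<in> measurable (F t) (count_space UNIV)" for b
    by (rule measurable_compose[OF candidates_measurable[OF assms(1)]]) simp
qed

lemma arm_measurable_of_rec_state:
  assumes "1 \<le> t" "rec_state B R (t - 1) \<in> measurable (F (t - 1)) (count_space UNIV)"
  shows "arm R t \<in> measurable (F (t - 1)) (count_space UNIV)"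
proof -
  have "(\<lambda>\<omega>. pol_arm R t \<omega> (rec_state B R (t - 1) \<omega>)) \<in> measurable (F (t - 1)) (count_space UNIV)"
    by (rule measurable_compose_countable[where f="\<lambda>s \<omega>. pol_arm R t \<omega> s",
          OF pol_arm_measurable[OF assms(1)] assms(2)])
  then show ?thesis
    by (subst measurable_cong[OF arm_eq[OF assms(1)]]) simp_all
qed

text \<open>The induction alternates: the state recovered at one time selects the next arm through a
  policy already fixed, and that arm with its candidate set determines the next recovered
  state.\<close>

lemma rec_state_measurable: "rec_state B R t \<in> measurable (F t) (count_space UNIV)"
proof (induction t)
  case 0
  have "rec_state B R 0 = state R 0" by (simp add: rec_state_def fun_eq_iff)
  then show ?case using state_measurable by simp
next
  case (Suc t)
  have "arm R (Suc t) \<in> measurable (F t) (count_space UNIV)"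
    using arm_measurable_of_rec_state[of "Suc t"] Suc by simp
  then have "arm R (Suc t) \<in> measurable (F (Suc t)) (count_space UNIV)"
    by (rule measurable_F_mono) simp
  from measurable_of_arm_candidates[OF _ this, of "\<lambda>b S. SOME s. pick_theta b S \<in> Theta B b s"]
  have "(\<lambda>\<omega>. SOME s. pick_theta (arm R (Suc t) \<omega>) (candidates (Suc t) \<omega>) \<in> Theta B (arm R (Suc t) \<omega>) s)
      \<in> measurable (F (Suc t)) (count_space UNIV)"
    by simp
  moreover have "rec_state B R (Suc t) =
      (\<lambda>\<omega>. SOME s. pick_theta (arm R (Suc t) \<omega>) (candidates (Suc t) \<omega>) \<in> Theta B (arm R (Suc t) \<omega>) s)"
    by (simp add: rec_state_def rec_theta_eq fun_eq_iff)
  ultimately show ?case by simp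
qed

lemma arm_measurable: "1 \<le> t \<Longrightarrow> arm R t \<in> measurable (F (t - 1)) (count_space UNIV)"
  using arm_measurable_of_rec_state rec_state_measurable by blast

lemma arm_measurable': "1 \<le> t \<Longrightarrow> arm R t \<in> measurable (F t) (count_space UNIV)"
  by (rule measurable_F_mono[OF arm_measurable]) simp_all

text \<open>The recovered state appears because the law of the action is given in terms of it;
  agreement with the true state is established only after that law has been exploited.\<close>

definition centre :: "nat \<Rightarrow> 'w \<Rightarrow> real^'n" where
  "centre t \<omega> = pol_action R t \<omega> (rec_state B R (t - 1) \<omega>)"

lemma centre_measurable: "1 \<le> t \<Longrightarrow> centre t \<in> borel_measurable (F (t - 1))"
  unfolding centre_def[abs_def]
  by (rule measurable_compose_countable[where f="\<lambda>s \<omega>. pol_action R t \<omega> s",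
        OF pol_action_measurable rec_state_measurable])


subsection \<open>The law of the action\<close>

abbreviation kernel :: "nat \<Rightarrow> 'w \<Rightarrow> (real^'n) set \<Rightarrow> real" where
  "kernel t \<omega> X \<equiv> measure (uniform_measure lborel (ball (centre t \<omega>) (\<delta> t) \<inter> action_set B)) X"

lemma kernel_measurable:
  assumes "1 \<le> t" "X \<in> sets borel"
  shows "(\<lambda>\<omega>. kernel t \<omega> X) \<in> borel_measurable M"
  by (rule measurable_compose[OF measurable_F[OF centre_measurable[OF assms(1)]]
        measurable_uniform_measure_ball[OF action_set_borel assms(2)]])

text \<open>The intersection has positive and finite volume, so the uniform law on it is a
  probability measure. The bound gives integrability in \<open>action_law\<close>.\<close>

lemma kernel_le_1:
  assumes "1 \<le> t" "\<omega> \<in> space M"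
  shows "kernel t \<omega> X \<le> 1"
proof -
  have "centre t \<omega> \<in> action_set B" using assms pol_action_mem by (simp add: centre_def)
  then have "emeasure lborel (ball (centre t \<omega>) (\<delta> t) \<inter> action_set B) \<noteq> 0"
    using emeasure_ball_Int_action_set_pos radius_pos[OF assms(1)] by fastforce
  then interpret K: prob_space "uniform_measure lborel (ball (centre t \<omega>) (\<delta> t) \<inter> action_set B)"
    using emeasure_ball_Int_lt_top by (intro prob_space_uniform_measure) (auto simp: less_top)
  show ?thesis by simp
qed

text \<open>Integrating the almost sure formula for the conditional expectation over an event
  \<open>E\<close> of the past yields an identity free of exceptional sets.\<close>

lemma joint_law:
  assumes t: "1 \<le> t" and E: "E \<in> sets (F (t - 1))" and X: "X \<in> sets borel"
  shows "measure M (E \<inter> {\<omega>\<in>space M. action R t \<omega> \<in> X \<and> state R t \<omega> = s \<and> theta R t \<omega> = v}) =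
    (\<integral>\<omega>. indicator E \<omega> * (kernel t \<omega> X * pmf (trans_law B (state R (t - 1) \<omega>)) s *
      pmf (Theta_law B (arm R t \<omega>) s) v) \<partial>M)"
    (is "measure M (E \<inter> ?A) = (\<integral>\<omega>. indicator E \<omega> * ?g \<omega> \<partial>M)")
proof -
  interpret finite_measure_subalgebra M "F (t - 1)"
    by unfold_locales (rule subalgebra_F)
  note [measurable] = measurable_F[OF state_measurable] measurable_F[OF theta_measurable[OF t]]
    measurable_F[OF action_measurable[OF t]] measurable_F[OF arm_measurable[OF t]] X
    kernel_measurable[OF t X]
  have E'[measurable]: "E \<in> sets M" using E subalg by (auto simp: subalgebra_def)
  have A[measurable]: "?A \<in> sets M" by measurable
  have g: "?g \<in> borel_measurable M" by measurable
  have "measure M (E \<inter> ?A) = (\<integral>\<omega>. indicator (E \<inter> ?A) \<omega> \<partial>M)"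
    using E' A by simp
  also have "\<dots> = (\<integral>\<omega>\<in>E. indicator ?A \<omega> \<partial>M)"
    by (simp add: set_lebesgue_integral_def indicator_inter_arith)
  also have "\<dots> = (\<integral>\<omega>\<in>E. real_cond_exp M (F (t - 1)) (indicator ?A) \<omega> \<partial>M)"
    by (rule real_cond_exp_intA[OF _ E]) (use A in \<open>simp add: less_top[symmetric]\<close>)
  also have "\<dots> = (\<integral>\<omega>. indicator E \<omega> * ?g \<omega> \<partial>M)"
    unfolding set_lebesgue_integral_def
  proof (rule integral_cong_AE)
    have "AE \<omega> in M. real_cond_exp M (F (t - 1)) (indicator ?A) \<omega> = ?g \<omega>"
      using run t X unfolding randomized_run_def centre_def by blast
    then show "AE \<omega> in M. indicator E \<omega> *\<^sub>R real_cond_exp M (F (t - 1)) (indicator ?A) \<omega>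
        = indicator E \<omega> * ?g \<omega>"
      by eventually_elim simp
  qed (use g in measurable)
  finally show ?thesis .
qed

text \<open>The events for the different pairs of state and vector partition the sample space.
  Summing the joint law over them removes both discrete laws, each having total mass 1 on the finite
  index sets.\<close>

lemma action_law:
  assumes t: "1 \<le> t" and E: "E \<in> sets (F (t - 1))" and X: "X \<in> sets borel"
  shows "measure M (E \<inter> {\<omega>\<in>space M. action R t \<omega> \<in> X}) = (\<integral>\<omega>. indicator E \<omega> * kernel t \<omega> X \<partial>M)"
proof -
  note [measurable] = measurable_F[OF state_measurable] measurable_F[OF theta_measurable[OF t]]
    measurable_F[OF action_measurable[OF t]] measurable_F[OF arm_measurable[OF t]] X
    kernel_measurable[OF t X]
  have E'[measurable]: "E \<in> sets M" using E subalgebra_F by (auto simp: subalgebra_def)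
  define A where "A = (\<lambda>(s, v). E \<inter> {\<omega>\<in>space M. action R t \<omega> \<in> X \<and> state R t \<omega> = s \<and> theta R t \<omega> = v})"
  define g where "g = (\<lambda>(s, v) \<omega>. indicator E \<omega> * (kernel t \<omega> X *
    pmf (trans_law B (state R (t - 1) \<omega>)) s * pmf (Theta_law B (arm R t \<omega>) s) v))"
  let ?I = "(UNIV :: 's set) \<times> vectors"
  have fin: "finite ?I" using finite_vectors by simp
  have A_sets: "A p \<in> sets M" for p
    unfolding A_def by (cases p) simp
  have g_int: "integrable M (g p)" for p
  proof (rule integrable_const_bound[where B=1])
    show "AE \<omega> in M. norm (g p \<omega>) \<le> 1"
      using kernel_le_1[OF t] by (intro AE_I2)
        (auto simp: g_def indicator_def abs_mult pmf_le_1 intro!: mult_le_one split: prod.split)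
    show "g p \<in> borel_measurable M"
      unfolding g_def by (cases p) simp
  qed
  have "E \<inter> {\<omega>\<in>space M. action R t \<omega> \<in> X} = (\<Union>p\<in>?I. A p)"
    using theta_mem_vectors[OF t] by (auto simp: A_def)
  moreover have "disjoint_family_on A ?I" by (auto simp: disjoint_family_on_def A_def)
  ultimately have "measure M (E \<inter> {\<omega>\<in>space M. action R t \<omega> \<in> X}) = (\<Sum>p\<in>?I. measure M (A p))"
    using fin A_sets by (simp add: finite_measure_finite_Union image_subset_iff)
  also have "\<dots> = (\<Sum>p\<in>?I. \<integral>\<omega>. g p \<omega> \<partial>M)"
    by (intro sum.cong) (auto simp: A_def g_def joint_law[OF t E X])
  also have "\<dots> = (\<integral>\<omega>. (\<Sum>p\<in>?I. g p \<omega>) \<partial>M)"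
    using g_int by (simp add: Bochner_Integration.integral_sum)
  also have "\<dots> = (\<integral>\<omega>. indicator E \<omega> * kernel t \<omega> X \<partial>M)"
  proof (rule Bochner_Integration.integral_cong)
    fix \<omega>
    have "(\<Sum>v\<in>vectors. pmf (Theta_law B (arm R t \<omega>) s) v) = 1" for s
    proof (rule sum_pmf_eq_1[OF finite_vectors])
      have "set_pmf (Theta_law B (arm R t \<omega>) s) \<subseteq> Theta B (arm R t \<omega>) s"
        using model by (simp add: bandit_model_def)
      then show "set_pmf (Theta_law B (arm R t \<omega>) s) \<subseteq> vectors"
        using Theta_subset_vectors by blast
    qed
    moreover have "(\<Sum>s\<in>UNIV. pmf (trans_law B (state R (t - 1) \<omega>)) s) = 1"
      by (rule sum_pmf_eq_1) auto
    ultimately have "(\<Sum>s\<in>UNIV. \<Sum>v\<in>vectors. g (s, v) \<omega>) = indicator E \<omega> * kernel t \<omega> X"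
      by (simp add: g_def flip: sum_distrib_left sum_distrib_right mult.assoc)
    then show "(\<Sum>p\<in>?I. g p \<omega>) = indicator E \<omega> * kernel t \<omega> X"
      by (simp add: sum.cartesian_product)
  qed simp
  finally show ?thesis .
qed

lemma AE_action_mem:
  assumes t: "1 \<le> t"
  shows "AE \<omega> in M. action R t \<omega> \<in> ball (centre t \<omega>) (\<delta> t) \<inter> action_set B"
  using AE_mem_of_conditionally_uniform[OF prob_space_axioms subalgebra_F centre_measurable[OF t]
      measurable_F[OF action_measurable[OF t]] action_set_borel action_law[OF t]] .

text \<open>All arms are pooled so that the set depends neither on the time nor on the sample point:
  the law of the action is available for fixed sets only.\<close>

definition degenerate :: "(real^'n) set" where
  "degenerate = (\<Union>v\<in>vectors. \<Union>w\<in>vectors - {v}. {a. (v - w) \<bullet> a = 0})"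

lemma degenerate_null: "degenerate \<in> null_sets lborel"
  unfolding degenerate_def using finite_vectors
  by (intro null_sets.finite_UN) (auto intro!: null_sets_lborel_hyperplane)

lemma cond_A2_if_not_degenerate:
  assumes "a \<notin> degenerate"
  shows "cond_A2 B b a"
  using assms Theta_arm_subset_vectors[of b]
  by (force simp: cond_A2_def degenerate_def inner_diff_right inner_commute)

lemma AE_action_not_degenerate:
  assumes t: "1 \<le> t"
  shows "AE \<omega> in M. action R t \<omega> \<notin> degenerate"
proof -
  have Z: "degenerate \<in> sets borel" using degenerate_null by (simp add: null_sets_def)
  have "emeasure lborel (S \<inter> degenerate) = 0" if "S \<in> sets borel" for S
    using degenerate_null that null_set_Int1[of degenerate lborel S] by (simp add: null_sets_def)
  \<comment> \<open>A uniform law on a ball piece is absolutely continuous, so this holds for every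
    centre and hence for the random one.\<close>
  then have "kernel t \<omega> degenerate = 0" for \<omega>
    using Z by (simp add: measure_def)
  then have "measure M {\<omega>\<in>space M. action R t \<omega> \<in> degenerate} = 0"
    using action_law[OF t sets.top Z] by (simp add: Int_absorb1 subset_eq Int_def)
  moreover have "{\<omega>\<in>space M. action R t \<omega> \<in> degenerate} \<in> sets M"
    using measurable_sets[OF measurable_F[OF action_measurable[OF t]] Z]
    by (simp add: vimage_def Int_def conj_commute)
  ultimately show ?thesis
    by (subst AE_iff_measurable[OF _ refl]) (auto simp: emeasure_eq_measure)
qed


subsection \<open>Exact recovery\<close>

text \<open>Off the hyperplanes the reward separates the vectors of the played arm, which leaves
  only the true vector; disjointness of the sets \<open>Theta B b s\<close> over \<open>s\<close>
  then identifies the state.\<close>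

lemma recovery_exact:
  assumes t: "1 \<le> t" and \<omega>: "\<omega> \<in> space M" and nd: "action R t \<omega> \<notin> degenerate"
  shows "v \<in> Theta B (arm R t \<omega>) s \<and> action R t \<omega> \<bullet> v = reward R t \<omega> \<longleftrightarrow>
      s = state R t \<omega> \<and> v = theta R t \<omega>"
    and "rec_theta B R t \<omega> = theta R t \<omega>" and "rec_state B R t \<omega> = state R t \<omega>"
proof -
  note th = theta_mem[OF t \<omega>]
  have arm: "v \<in> Theta_arm B (arm R t \<omega>) \<and> action R t \<omega> \<bullet> v = reward R t \<omega> \<longleftrightarrow> v = theta R t \<omega>" for v
    using cond_A2_if_not_degenerate[OF nd, of "arm R t \<omega>"] th
    by (auto simp: cond_A2_def reward_def Theta_arm_def)
  then show "rec_theta B R t \<omega> = theta R t \<omega>"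
    by (simp add: rec_theta_def)
  then show "rec_state B R t \<omega> = state R t \<omega>"
    using t th by (auto simp: rec_state_def intro: Theta_state_unique someI)
  show "v \<in> Theta B (arm R t \<omega>) s \<and> action R t \<omega> \<bullet> v = reward R t \<omega> \<longleftrightarrow>
      s = state R t \<omega> \<and> v = theta R t \<omega>"
    using arm[of v] th Theta_state_unique by (auto simp: Theta_arm_def)
qed

text \<open>There are countably many times, so a single null set serves all of them; the later
  almost sure claims are drawn from this event.\<close>

lemma AE_recovery:
  "AE \<omega> in M. \<forall>t\<ge>1. action R t \<omega> \<in> ball (centre t \<omega>) (\<delta> t) \<inter> action_set B \<and>
      action R t \<omega> \<notin> degenerate"
  using AE_action_mem AE_action_not_degenerate by (auto simp: AE_all_countable)

lemma rec_state_exact: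
  assumes "\<omega> \<in> space M" "\<forall>t\<ge>1. action R t \<omega> \<notin> degenerate"
  shows "rec_state B R t \<omega> = state R t \<omega>"
proof (cases "t = 0")
  case True
  then show ?thesis by (simp add: rec_state_def)
next
  case False
  then show ?thesis using assms recovery_exact(3)[of t \<omega>] by simp
qed

lemma unrecoverable_null:
  assumes t: "1 \<le> t"
  shows "unrecoverable B M R t \<in> null_sets M"
proof -
  \<comment> \<open>Membership in \<open>null_sets\<close> includes measurability; writing the
    failure of uniqueness as a function of arm and candidate set provides it.\<close>
  define u where "u = (\<lambda>b S. \<not> (\<exists>!(s, v). v \<in> Theta B b s \<and> v \<in> S))"
  have u: "(\<not> (\<exists>!(s, v). v \<in> Theta B (arm R t \<omega>) s \<and> action R t \<omega> \<bullet> v = reward R t \<omega>)) \<longleftrightarrow>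
      u (arm R t \<omega>) (candidates t \<omega>)" for \<omega>
  proof -
    have "(\<lambda>(s, v). v \<in> Theta B (arm R t \<omega>) s \<and> action R t \<omega> \<bullet> v = reward R t \<omega>) =
        (\<lambda>(s, v). v \<in> Theta B (arm R t \<omega>) s \<and> v \<in> candidates t \<omega>)"
      using Theta_subset_vectors by (auto simp: candidates_def fun_eq_iff)
    then show ?thesis by (simp add: u_def)
  qed
  have "(\<lambda>\<omega>. u (arm R t \<omega>) (candidates t \<omega>)) \<in> measurable M (count_space UNIV)"
    by (rule measurable_F[OF measurable_of_arm_candidates[OF t arm_measurable'[OF t]]])
  then have meas: "unrecoverable B M R t \<in> sets M"
    unfolding unrecoverable_def u by (simp add: pred_def)
  have "AE \<omega> in M. \<omega> \<notin> unrecoverable B M R t"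
    using AE_recovery
  proof (rule AE_mp, intro AE_I2 impI)
    fix \<omega> assume "\<omega> \<in> space M"
      and "\<forall>t\<ge>1. action R t \<omega> \<in> ball (centre t \<omega>) (\<delta> t) \<inter> action_set B \<and> action R t \<omega> \<notin> degenerate"
    then have "\<exists>!p. case p of (s, v) \<Rightarrow> v \<in> Theta B (arm R t \<omega>) s \<and> action R t \<omega> \<bullet> v = reward R t \<omega>"
      using recovery_exact(1)[OF t] t by (intro ex1I[of _ "(state R t \<omega>, theta R t \<omega>)"]) auto
    then show "\<omega> \<notin> unrecoverable B M R t"
      by (simp add: unrecoverable_def)
  qed
  then show ?thesis
    using meas by (simp add: AE_iff_null_sets)
qed

lemma reward_measurable: "1 \<le> t \<Longrightarrow> reward R t \<in> borel_measurable M"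
  unfolding reward_def[abs_def]
  using measurable_F[OF action_measurable] measurable_F[OF theta_measurable] by measurable

lemma estimation_error_null: "estimation_error B M R T \<in> null_sets M"
proof -
  have "{\<omega>\<in>space M. rec_state B R t \<omega> \<noteq> state R t \<omega> \<or> rec_theta B R t \<omega> \<noteq> theta R t \<omega>} \<in> sets M"
    if t: "1 \<le> t" for t
  proof -
    note [measurable] = measurable_F[OF state_measurable] measurable_F[OF rec_state_measurable]
      measurable_F[OF theta_measurable[OF t]]
    have "rec_theta B R t \<in> measurable M (count_space UNIV)"
      unfolding rec_theta_eq[abs_def]
      by (rule measurable_F[OF measurable_of_arm_candidates[OF t arm_measurable'[OF t]]])
    then have [measurable]: "rec_theta B R t \<in> borel_measurable M"
      by (rule measurable_compose) simp
    show ?thesis by measurable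
  qed
  then have "(\<Union>t\<in>{1..T}. {\<omega>\<in>space M. rec_state B R t \<omega> \<noteq> state R t \<omega> \<or>
      rec_theta B R t \<omega> \<noteq> theta R t \<omega>}) \<in> sets M"
    by (intro sets.finite_UN) auto
  also have "(\<Union>t\<in>{1..T}. {\<omega>\<in>space M. rec_state B R t \<omega> \<noteq> state R t \<omega> \<or>
      rec_theta B R t \<omega> \<noteq> theta R t \<omega>}) = estimation_error B M R T"
    by (auto simp: estimation_error_def)
  finally have "estimation_error B M R T \<in> sets M" .
  moreover have "AE \<omega> in M. \<omega> \<notin> estimation_error B M R T"
    using AE_recovery
    by (rule AE_mp, intro AE_I2) (auto simp: estimation_error_def recovery_exact)
  ultimately show ?thesis by (simp add: AE_iff_null_sets)
qed

text \<open>The regret is multiplied by the indicator of a null event, so the product vanishes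
  almost surely.\<close>

lemma error_regret_integral:
  "integrable M (error_regret B \<pi> M R T)" "integral\<^sup>L M (error_regret B \<pi> M R T) = 0"
proof -
  have [measurable]: "estimation_error B M R T \<in> sets M"
    using estimation_error_null by auto
  have "regret B \<pi> (reward R) T \<in> borel_measurable M"
    unfolding regret_def[abs_def] using reward_measurable by measurable
  then have m: "error_regret B \<pi> M R T \<in> borel_measurable M"
    unfolding error_regret_def[abs_def] by measurable
  have z: "AE \<omega> in M. error_regret B \<pi> M R T \<omega> = 0"
    using AE_not_in[OF estimation_error_null[of T]]
    by eventually_elim (simp add: error_regret_def)
  show "integrable M (error_regret B \<pi> M R T)"
    using integrable_cong_AE[OF m _ z] by simp
  show "integral\<^sup>L M (error_regret B \<pi> M R T) = 0"
    using integral_cong_AE[OF m _ z] by simp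
qed


subsection \<open>The cost of recovery\<close>

text \<open>The benchmark term \<open>real T * rho B \<pi>\<close> cancels between the two
  regrets.\<close>

lemma recovery_regret_eq:
  "recovery_regret B \<pi> R T \<omega> =
    (\<Sum>t=1..T. (pol_action R t \<omega> (state R (t - 1) \<omega>) - action R t \<omega>) \<bullet> theta R t \<omega>)"
  by (simp add: recovery_regret_def regret_def reward_def inner_diff_left sum_subtractf)

lemma AE_recovery_regret_bound:
  "AE \<omega> in M. \<forall>T. \<bar>recovery_regret B \<pi> R T \<omega>\<bar> \<le> (\<Sum>t=1..T. \<delta> t * Max (norm1 ` vectors))"
  using AE_recovery
proof (rule AE_mp, intro AE_I2 impI allI)
  fix \<omega> T assume \<omega>: "\<omega> \<in> space M"
    and rec: "\<forall>t\<ge>1. action R t \<omega> \<in> ball (centre t \<omega>) (\<delta> t) \<inter> action_set B \<and> action R t \<omega> \<notin> degenerate"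
  have "\<bar>(pol_action R t \<omega> (state R (t - 1) \<omega>) - action R t \<omega>) \<bullet> theta R t \<omega>\<bar>
      \<le> \<delta> t * Max (norm1 ` vectors)" if t: "t \<in> {1..T}" for t
  proof -
    \<comment> \<open>Exact recovery of the previous state turns the centre of the ball into the
      action prescribed at the true state.\<close>
    have "pol_action R t \<omega> (state R (t - 1) \<omega>) = centre t \<omega>"
      using rec_state_exact[OF \<omega>] rec by (simp add: centre_def)
    then have "norm (pol_action R t \<omega> (state R (t - 1) \<omega>) - action R t \<omega>) \<le> \<delta> t"
      using rec t by (auto simp: dist_norm less_imp_le)
    moreover have "norm (theta R t \<omega>) \<le> Max (norm1 ` vectors)"
    proof -
      have "norm (theta R t \<omega>) \<le> norm1 (theta R t \<omega>)"
        by (simp add: norm1_def norm_le_l1_cart)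
      also have "\<dots> \<le> Max (norm1 ` vectors)"
        using finite_vectors theta_mem_vectors[OF _ \<omega>] t by (intro Max_ge) auto
      finally show ?thesis .
    qed
    ultimately show ?thesis
      using t radius_pos[of t]
      by (intro order_trans[OF Cauchy_Schwarz_ineq2] mult_mono) auto
  qed
  then show "\<bar>recovery_regret B \<pi> R T \<omega>\<bar> \<le> (\<Sum>t=1..T. \<delta> t * Max (norm1 ` vectors))"
    unfolding recovery_regret_eq by (intro order_trans[OF sum_abs] sum_mono)
qed

lemma recovery_regret_measurable: "recovery_regret B \<pi> R T \<in> borel_measurable M"
proof -
  have "(\<lambda>\<omega>. pol_action R t \<omega> (state R (t - 1) \<omega>)) \<in> borel_measurable M" if "1 \<le> t" for t
    by (rule measurable_F[OF measurable_compose_countable[where f="\<lambda>s \<omega>. pol_action R t \<omega> s",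
            OF pol_action_measurable[OF that] state_measurable]])
  then show ?thesis
    unfolding recovery_regret_eq[abs_def]
    using measurable_F[OF action_measurable] measurable_F[OF theta_measurable]
    by (intro borel_measurable_sum borel_measurable_inner borel_measurable_diff) auto
qed

text \<open>This permits conditioning on all the actions played, the sense in which an expected
  regret can be bounded with probability one.\<close>

lemma subalgebra_action_algebra: "subalgebra M (action_algebra M R)"
proof -
  have "{action R t -` X \<inter> space M | t X. t \<ge> 1 \<and> X \<in> sets borel} \<subseteq> sets M"
    using measurable_sets[OF measurable_F[OF action_measurable]] by auto
  then have "sigma_sets (space M) {action R t -` X \<inter> space M | t X. t \<ge> 1 \<and> X \<in> sets borel} \<subseteq> sets M"
    by (rule sets.sigma_sets_subset)
  moreover have "{action R t -` X \<inter> space M | t X. t \<ge> 1 \<and> X \<in> sets borel} \<subseteq> Pow (space M)"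
    by auto
  ultimately show ?thesis
    unfolding action_algebra_def subalgebra_def by (simp only: space_measure_of sets_measure_of)
qed

end

section \<open>The total cost of the shrinking radii\<close>

lemma norm_le_norm1: "norm x \<le> norm1 x"
  by (simp add: norm1_def norm_le_l1_cart)

text \<open>The maximal norm cancels against its inverse in \<open>eps_seq\<close>, leaving
  \<open>\<epsilon> / \<gamma>\<close> times a partial sum of the series. Since \<gamma> strictly
  exceeds the whole sum, one bound below \<epsilon> serves all horizons.\<close>

lemma eps_seq_budget:
  fixes B :: "('b::finite, 's::finite, 'n::finite) bandit"
  assumes "bandit_model B" and "\<exists>b. \<exists>v\<in>Theta_arm B b. v \<noteq> 0" and "\<epsilon> > 0" and "\<beta> > 1"
    and \<gamma>: "\<gamma> > (\<Sum>t. real (Suc t) powr (- \<beta>))"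
  shows "1 \<le> t \<Longrightarrow> 0 < eps_seq B \<epsilon> \<gamma> \<beta> t"
    and "\<exists>\<eta><\<epsilon>. \<forall>T. (\<Sum>t=1..T. eps_seq B \<epsilon> \<gamma> \<beta> t * Max (norm1 ` (\<Union>b. Theta_arm B b))) \<le> \<eta>"
proof -
  let ?L = "Max (norm1 ` (\<Union>b. Theta_arm B b))" and ?S = "\<Sum>t. real (Suc t) powr (- \<beta>)"
  obtain b v where v: "v \<in> Theta_arm B b" "v \<noteq> 0" using assms by blast
  have fin: "finite (\<Union>b. Theta_arm B b)"
    using assms(1) by (simp add: Theta_arm_def bandit_model_def)
  \<comment> \<open>A nonzero vector makes the maximum positive. With maximum 0 the
    \<open>inverse\<close> in \<open>eps_seq\<close> would be 0 and the open balls empty.\<close>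
  have "0 < norm v" using v by simp
  also have "\<dots> \<le> norm1 v" by (rule norm_le_norm1)
  also have "\<dots> \<le> ?L" using v fin by (intro Max_ge) auto
  finally have L: "0 < ?L" .
  have summ: "summable (\<lambda>t. real (Suc t) powr (- \<beta>))"
    using \<open>\<beta> > 1\<close> summable_real_powr_iff[of "- \<beta>"]
      summable_Suc_iff[of "\<lambda>t. real t powr (- \<beta>)"] by simp
  have "0 \<le> ?S" by (intro suminf_nonneg summ) simp
  with \<gamma> have \<gamma>0: "0 < \<gamma>" by simp
  show "0 < eps_seq B \<epsilon> \<gamma> \<beta> t" if "1 \<le> t"
    using that L \<gamma>0 \<open>\<epsilon> > 0\<close> by (simp add: eps_seq_def)
  have "(\<Sum>t=1..T. eps_seq B \<epsilon> \<gamma> \<beta> t * ?L) \<le> \<epsilon> / \<gamma> * ?S" for T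
  proof -
    have "(\<Sum>t=1..T. eps_seq B \<epsilon> \<gamma> \<beta> t * ?L) = (\<Sum>t=1..T. \<epsilon> / \<gamma> * real t powr (- \<beta>))"
      using L by (intro sum.cong) (auto simp: eps_seq_def powr_minus field_simps)
    also have "\<dots> = \<epsilon> / \<gamma> * (\<Sum>t<T. real (Suc t) powr (- \<beta>))"
      by (simp add: sum_distrib_left sum.atLeast1_atMost_eq)
    also have "\<dots> \<le> \<epsilon> / \<gamma> * ?S"
      using \<gamma>0 \<open>\<epsilon> > 0\<close> by (intro mult_left_mono sum_le_suminf summ) auto
    finally show ?thesis .
  qed
  moreover have "\<epsilon> / \<gamma> * ?S < \<epsilon>"
    using \<gamma> \<gamma>0 \<open>\<epsilon> > 0\<close> by (simp add: field_simps)
  ultimately show "\<exists>\<eta><\<epsilon>. \<forall>T. (\<Sum>t=1..T. eps_seq B \<epsilon> \<gamma> \<beta> t * ?L) \<le> \<eta>" by blast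
qed

section \<open>Recovery and cost combined for the radii \<open>eps_seq\<close>\<close>

theorem mainTheorem2:
  fixes B :: "('b::finite, 's::finite, 'n::finite) bandit"
    and M :: "'w measure" and F :: "nat \<Rightarrow> 'w measure" and R :: "('w, 'b, 's, 'n) run"
    and \<pi> :: "'s \<Rightarrow> 'b \<times> (real^'n)" and \<alpha> \<epsilon> \<alpha>\<^sub>\<epsilon> \<gamma> :: real
  assumes "bandit_model B"
    and "\<exists>b. \<exists>v\<in>Theta_arm B b. v \<noteq> 0"
    and "optimal_policy B \<pi>"
    and "\<alpha> > 3" and "\<epsilon> > 0" and "\<alpha>\<^sub>\<epsilon> > 1"
    and "\<gamma> > (\<Sum>t. real (Suc t) powr (- \<alpha>\<^sub>\<epsilon>))"
    and "randomized_run B (eps_seq B \<epsilon> \<gamma> \<alpha>\<^sub>\<epsilon>) M F R"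
    and "plays_algorithm B \<alpha> M R"
  shows
    \<comment> \<open>(i)\<close>
    "(\<forall>t\<ge>1. \<forall>\<omega>\<in>space M. \<exists>a.
        cond_A1 B (eps_seq B \<epsilon> \<gamma> \<alpha>\<^sub>\<epsilon> t) (pol_action R t \<omega> (state R (t - 1) \<omega>)) a \<and>
        cond_A2 B (pol_arm R t \<omega> (state R (t - 1) \<omega>)) a) \<and>
     (AE \<omega> in M. \<forall>t\<ge>1.
        cond_A1 B (eps_seq B \<epsilon> \<gamma> \<alpha>\<^sub>\<epsilon> t) (pol_action R t \<omega> (state R (t - 1) \<omega>)) (action R t \<omega>) \<and>
        cond_A2 B (pol_arm R t \<omega> (state R (t - 1) \<omega>)) (action R t \<omega>)) \<and>
     (\<forall>t\<ge>1. unrecoverable B M R t \<in> null_sets M) \<and>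
     (AE \<omega> in M. \<forall>t\<ge>1. arm R t \<omega> = pol_arm R t \<omega> (state R (t - 1) \<omega>) \<and>
        rec_state B R t \<omega> = state R t \<omega> \<and> rec_theta B R t \<omega> = theta R t \<omega>) \<and>
     (\<forall>T. integrable M (error_regret B \<pi> M R T) \<and>
          integral\<^sup>L M (error_regret B \<pi> M R T) = 0) \<and>
    \<comment> \<open>(ii)\<close>
     (\<forall>T. integrable M (recovery_regret B \<pi> R T)) \<and>
     (SUP T. ereal (integral\<^sup>L M (recovery_regret B \<pi> R T))) < ereal \<epsilon> \<and>
     (AE \<omega> in M. \<forall>T.
        real_cond_exp M (action_algebra M R) (recovery_regret B \<pi> R T) \<omega> < \<epsilon>) \<and>
     (AE \<omega> in M. \<forall>T. recovery_regret B \<pi> R T \<omega> < \<epsilon>)"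
proof -
  interpret recovery_run B \<alpha> "eps_seq B \<epsilon> \<gamma> \<alpha>\<^sub>\<epsilon>" M F R
    using assms eps_seq_budget(1)[OF assms(1,2,5-7)] by unfold_locales auto
  \<comment> \<open>A bound strictly below \<epsilon> and uniform in the horizon keeps the
    inequality strict after the supremum over \<open>T\<close>.\<close>
  obtain \<eta> where \<eta>: "\<eta> < \<epsilon>"
    and budget: "\<And>T. (\<Sum>t=1..T. eps_seq B \<epsilon> \<gamma> \<alpha>\<^sub>\<epsilon> t * Max (norm1 ` vectors)) \<le> \<eta>"
    using eps_seq_budget(2)[OF assms(1,2,5-7)] unfolding vectors_def by blast
  have bound: "AE \<omega> in M. \<forall>T. \<bar>recovery_regret B \<pi> R T \<omega>\<bar> \<le> \<eta>"
    using AE_recovery_regret_bound[of \<pi>] by eventually_elim (use budget order_trans in blast)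
  \<comment> \<open>Existence holds at every sample point: a set of positive volume cannot lie
    inside the null set \<open>degenerate\<close>.\<close>
  have A1_A2: "\<exists>a. cond_A1 B (eps_seq B \<epsilon> \<gamma> \<alpha>\<^sub>\<epsilon> t) (pol_action R t \<omega> s) a \<and> cond_A2 B b a"
    if "1 \<le> t" "\<omega> \<in> space M" for t \<omega> s b
  proof -
    let ?S = "ball (pol_action R t \<omega> s) (eps_seq B \<epsilon> \<gamma> \<alpha>\<^sub>\<epsilon> t) \<inter> action_set B"
    have "0 < emeasure lborel ?S"
      by (rule emeasure_ball_Int_action_set_pos[OF pol_action_mem[OF that] radius_pos[OF that(1)]])
    then have "?S \<notin> null_sets lborel" by (auto simp: null_sets_def)
    then have "\<not> ?S \<subseteq> degenerate"
      using null_sets_subset[OF degenerate_null, of ?S] by auto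
    then show ?thesis
      using cond_A2_if_not_degenerate by (auto simp: cond_A1_def)
  qed
  have AE_all: "AE \<omega> in M. \<forall>t\<ge>1.
      cond_A1 B (eps_seq B \<epsilon> \<gamma> \<alpha>\<^sub>\<epsilon> t) (pol_action R t \<omega> (state R (t - 1) \<omega>)) (action R t \<omega>) \<and>
      cond_A2 B (pol_arm R t \<omega> (state R (t - 1) \<omega>)) (action R t \<omega>) \<and>
      arm R t \<omega> = pol_arm R t \<omega> (state R (t - 1) \<omega>) \<and>
      rec_state B R t \<omega> = state R t \<omega> \<and> rec_theta B R t \<omega> = theta R t \<omega>"
    using AE_recovery
  proof (rule AE_mp, intro AE_I2 impI allI)
    fix \<omega> and t :: nat
    assume \<omega>: "\<omega> \<in> space M" and t: "1 \<le> t"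
      and rec: "\<forall>t\<ge>1. action R t \<omega> \<in> ball (centre t \<omega>) (eps_seq B \<epsilon> \<gamma> \<alpha>\<^sub>\<epsilon> t) \<inter> action_set B \<and>
        action R t \<omega> \<notin> degenerate"
    \<comment> \<open>Agreement at all times, in particular at \<open>t - 1\<close>, where the
      recovered state determines both the arm and the centre.\<close>
    have "rec_state B R i \<omega> = state R i \<omega>" for i
      using rec_state_exact[OF \<omega>] rec by simp
    then show "cond_A1 B (eps_seq B \<epsilon> \<gamma> \<alpha>\<^sub>\<epsilon> t) (pol_action R t \<omega> (state R (t - 1) \<omega>)) (action R t \<omega>) \<and>
        cond_A2 B (pol_arm R t \<omega> (state R (t - 1) \<omega>)) (action R t \<omega>) \<and>
        arm R t \<omega> = pol_arm R t \<omega> (state R (t - 1) \<omega>) \<and>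
        rec_state B R t \<omega> = state R t \<omega> \<and> rec_theta B R t \<omega> = theta R t \<omega>"
      using rec t \<omega> arm_eq[OF t \<omega>] recovery_exact(2)[OF t \<omega>]
      by (simp add: cond_A1_def centre_def cond_A2_if_not_degenerate)
  qed
  have int: "integrable M (recovery_regret B \<pi> R T)" for T
    using bound by (intro integrable_const_bound[where B=\<eta>] recovery_regret_measurable)
      (auto elim: eventually_mono)
  have "integral\<^sup>L M (recovery_regret B \<pi> R T) \<le> \<eta>" for T
  proof -
    have "integral\<^sup>L M (recovery_regret B \<pi> R T) \<le> (\<integral>\<omega>. \<eta> \<partial>M)"
      using bound by (intro integral_mono_AE int) (auto elim!: eventually_mono intro: abs_le_D1)
    then show ?thesis by (simp add: prob_space)
  qed
  then have "(SUP T. ereal (integral\<^sup>L M (recovery_regret B \<pi> R T))) \<le> ereal \<eta>"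
    by (intro SUP_least) simp
  also have "\<dots> < ereal \<epsilon>" using \<eta> by simp
  finally have sup: "(SUP T. ereal (integral\<^sup>L M (recovery_regret B \<pi> R T))) < ereal \<epsilon>" .
  interpret A: finite_measure_subalgebra M "action_algebra M R"
    by unfold_locales (rule subalgebra_action_algebra)
  \<comment> \<open>Conditional expectation is monotone, so the almost sure bound \<eta> passes to
    it; the horizons are countably many and share one null set.\<close>
  have cond: "AE \<omega> in M. \<forall>T. real_cond_exp M (action_algebra M R) (recovery_regret B \<pi> R T) \<omega> < \<epsilon>"
    unfolding AE_all_countable
  proof
    fix T
    have "AE \<omega> in M. real_cond_exp M (action_algebra M R) (recovery_regret B \<pi> R T) \<omega> \<le> \<eta>"
      using bound by (intro A.real_cond_exp_le_c int) (auto elim!: eventually_mono intro: abs_le_D1)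
    then show "AE \<omega> in M. real_cond_exp M (action_algebra M R) (recovery_regret B \<pi> R T) \<omega> < \<epsilon>"
      by eventually_elim (use \<eta> in simp)
  qed
  have path: "AE \<omega> in M. \<forall>T. recovery_regret B \<pi> R T \<omega> < \<epsilon>"
    using bound
  proof eventually_elim
    case (elim \<omega>)
    then show ?case using \<eta> by (meson abs_le_D1 le_less_trans)
  qed
  show ?thesis
    using A1_A2 AE_all unrecoverable_null error_regret_integral int sup cond path
    by (intro conjI allI impI ballI) (auto elim!: eventually_mono)
qed

end
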